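(* For every $r\geq 2$ there exist preferences $\mathcal{A}=(A^j_i)_{i,j=1}^r$ of $r$ players on cuts of $[0,1]$ into $r$ tiles, such that every $A^j_i$ is closed, $\bigcup_{i=1}^r A^j_i=\Delta^{r-1}$ for every $j$, each $A^j_i$ is disjoint from the facet $\{x_i=0\}$ of $\Delta^{r-1}$, and $\mathcal{A}$ admits exactly two different envy-free divisions.
   Context: The cake is the segment $[0,1]$. A cut into $r$ pieces is a point $x=(x_1,\dots,x_r)$ of the standard simplex $\Delta^{r-1}=\{x\in\mathbb{R}^r: x_i\geq 0,\ \sum_i x_i=1\}$; the tiles of the cut are the consecutive closed subintervals of $[0,1]$ of lengths $x_1,\dots,x_r$. Preferences of $r$ players are a matrix of subsets $A^j_i\subseteq\Delta^{r-1}$, interpreted as: $x\in A^j_i$ iff in the cut $x$ player $j$ prefers tile $i$. A division is a pair $(x,\pi)$ of a cut $x$ and a bijection $\pi$ from players $[r]$ to tiles $[r]$; it is envy-free if $x\in A^j_{\pi(j)}$ for all $j$. Divisions are different if the pairs differ. *)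

theory Defs
  imports "HOL-Homology.Simplices" "HOL-Combinatorics.Permutations"
begin

text \<open>
  Players and tiles are both indexed by \<open>{..<r}\<close>. A point of \<open>\<Delta>\<^sup>r\<^sup>-\<^sup>1\<close> is an element
  \<open>x :: nat \<Rightarrow> real\<close> of the library's \<open>standard_simplex (r - 1)\<close>, so \<open>x i\<close> is
  \<open>0\<close> for \<open>i \<ge> r\<close>; tile \<open>i\<close> of the cut \<open>x\<close> is the interval
  \<open>{(\<Sum>k<i. x k) .. (\<Sum>k\<le>i. x k)}\<close>, of length \<open>x i\<close>. The product topology on
  \<open>nat \<Rightarrow> real\<close> induces the usual Euclidean topology on the simplex.
\<close>

abbreviation cuts :: "nat \<Rightarrow> (nat \<Rightarrow> real) set" where
  "cuts r \<equiv> standard_simplex (r - 1)"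

text \<open>
  \<open>x \<in> A j i\<close> means that player \<open>j\<close> prefers tile \<open>i\<close> in the cut \<open>x\<close>. The values
  \<open>A j i\<close> with \<open>j \<ge> r\<close> or \<open>i \<ge> r\<close> are irrelevant.
\<close>

type_synonym preference_matrix = "nat \<Rightarrow> nat \<Rightarrow> (nat \<Rightarrow> real) set"

definition preferences :: "nat \<Rightarrow> preference_matrix \<Rightarrow> bool" where
  "preferences r A \<longleftrightarrow> (\<forall>j<r. \<forall>i<r. A j i \<subseteq> cuts r)"

text \<open>
  A bijection from players to tiles is represented by the unique function that extends it by
  the identity outside \<open>{..<r}\<close>, so that distinct divisions are distinct pairs.
\<close>

definition divisions :: "nat \<Rightarrow> ((nat \<Rightarrow> real) \<times> (nat \<Rightarrow> nat)) set" where
  "divisions r = cuts r \<times> {\<pi>. \<pi> permutes {..<r}}"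

definition envy_free_divisions ::
    "nat \<Rightarrow> preference_matrix \<Rightarrow> ((nat \<Rightarrow> real) \<times> (nat \<Rightarrow> nat)) set" where
  "envy_free_divisions r A = {(x, \<pi>) \<in> divisions r. \<forall>j<r. x \<in> A j (\<pi> j)}"

end

theory Submission
  imports Defs
begin

text \<open>
  Arrange the tiles in a cycle. Player \<open>j\<close> compares the lengths of the tiles, counting the tiles
  \<open>j\<close> and \<open>j + 1\<close> in full and all others at half their length, and prefers those that come out
  longest. If \<open>(x, \<pi>)\<close> is envy-free, then \<open>x j \<le> weight j (\<pi> j) * x (\<pi> j) \<le> x (\<pi> j)\<close> for every
  \<open>j\<close>. Summing over \<open>j\<close> forces equality throughout, so player \<open>j\<close> receives tile \<open>j\<close> or \<open>j + 1\<close>,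
  and comparison with tile \<open>j + 1\<close> gives \<open>x (j + 1) \<le> x j\<close>. Going round the cycle, all tiles
  have length \<open>1 / r\<close>, and \<open>\<pi>\<close> is the identity or the rotation.
\<close>

text \<open>Indices from \<open>r\<close> on are fixed because \<open>divisions\<close> represents a
  bijection of \<open>{..<r}\<close> by its extension with the identity.\<close>

definition rotation :: "nat \<Rightarrow> nat \<Rightarrow> nat" where
  "rotation r i = (if i < r then if Suc i = r then 0 else Suc i else i)"

lemma rotation_less: "i < r \<Longrightarrow> rotation r i < r"
  by (auto simp: rotation_def)

lemma rotation_neq: "r \<ge> 2 \<Longrightarrow> i < r \<Longrightarrow> rotation r i \<noteq> i"
  by (auto simp: rotation_def)

lemma rotation_permutes: "rotation r permutes {..<r}"
proof (rule bij_imp_permutes)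
  have "inj_on (rotation r) {..<r}"
    by (auto simp: inj_on_def rotation_def split: if_splits)
  moreover have "rotation r ` {..<r} \<subseteq> {..<r}"
    by (auto simp: rotation_less)
  ultimately show "bij_betw (rotation r) {..<r} {..<r}"
    by (simp add: bij_betw_def endo_inj_surj)
qed (auto simp: rotation_def)

text \<open>Induction round the cycle from an arbitrary start: climb from \<open>i\<close> to
  \<open>r - 1\<close>, wrap to \<open>0\<close>, climb again to \<open>k\<close>.\<close>

lemma rotation_induct:
  assumes "i < r" "P i" and step: "\<And>j. j < r \<Longrightarrow> P j \<Longrightarrow> P (rotation r j)" and "k < r"
  shows "P k"
proof -
  have up: "P m" if "n \<le> m" "m < r" "P n" for n m
    using that
  proof (induction m rule: dec_induct)
    case (step m)
    then show ?case using assms(3)[of m] by (simp add: rotation_def)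
  qed
  have "P (r - 1)" using up[of i "r - 1"] assms by simp
  then have "P 0" using step[of "r - 1"] \<open>i < r\<close> by (simp add: rotation_def)
  then show ?thesis using up[of 0 k] \<open>k < r\<close> by simp
qed

lemma permutes_id_or_rotation:
  assumes "r \<ge> 2" "\<pi> permutes {..<r}"
    and range: "\<And>j. j < r \<Longrightarrow> \<pi> j = j \<or> \<pi> j = rotation r j"
  shows "\<pi> = id \<or> \<pi> = rotation r"
proof (cases "\<exists>i<r. \<pi> i = rotation r i")
  case True
  then obtain i where i: "i < r" "\<pi> i = rotation r i" by blast
  \<comment> \<open>Tile \<open>rotation r j\<close> is already taken by player \<open>j\<close>, so
    by injectivity the player of that index must move on as well. A single rotated player thus
    forces all the others.\<close>
  have "\<pi> (rotation r j) = rotation r (rotation r j)" if "j < r" "\<pi> j = rotation r j" for j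
    using that range[of "rotation r j"] rotation_less[of j r] rotation_neq[of r j]
      permutes_inj[OF assms(2)] assms(1)
    by (metis injD)
  then have "\<pi> k = rotation r k" if "k < r" for k
    using rotation_induct[where P = "\<lambda>j. \<pi> j = rotation r j", OF i(1,2) _ that] by blast
  then have "\<pi> k = rotation r k" for k
    using permutes_not_in[OF assms(2), of k] permutes_not_in[OF rotation_permutes, of k r]
    by (cases "k < r") auto
  then show ?thesis by blast
next
  case False
  then have "\<pi> k = k" for k
    using range permutes_not_in[OF assms(2), of k] by (cases "k < r") auto
  then show ?thesis by auto
qed

lemma cuts_iff:
  assumes "r > 0"
  shows "x \<in> cuts r \<longleftrightarrow> (\<forall>i. 0 \<le> x i \<and> x i \<le> 1) \<and> (\<forall>i\<ge>r. x i = 0) \<and> (\<Sum>i<r. x i) = 1"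
proof -
  \<comment> \<open>Positivity of \<open>r\<close> matters: at \<open>r = 0\<close> truncated
    subtraction would still leave the index \<open>0\<close>.\<close>
  have "{..r - 1} = {..<r}" "\<And>i. i > r - 1 \<longleftrightarrow> i \<ge> r" using assms by auto
  then show ?thesis by (simp add: standard_simplex_def)
qed

definition equal_cut :: "nat \<Rightarrow> nat \<Rightarrow> real" where
  "equal_cut r i = (if i < r then 1 / real r else 0)"

lemma equal_cut_in_cuts: "r > 0 \<Longrightarrow> equal_cut r \<in> cuts r"
  by (simp add: cuts_iff equal_cut_def del: One_nat_def)

lemma cut_eq_equal_cut:
  assumes "r > 0" "x \<in> cuts r" and descent: "\<And>j. j < r \<Longrightarrow> x (rotation r j) \<le> x j"
  shows "x = equal_cut r"
proof
  fix i
  \<comment> \<open>Lengths do not increase along the cycle, and any index can be reached from any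
    other; so any two lengths are comparable in both directions.\<close>
  have le: "x k \<le> x j" if "j < r" "k < r" for j k
    using rotation_induct[where P = "\<lambda>k. x k \<le> x j" and k = k and r = r, OF that(1) _ _ that(2)]
      descent order_trans
    by blast
  show "x i = equal_cut r i"
  proof (cases "i < r")
    case True
    then have "(\<Sum>k<r. x k) = (\<Sum>k<r. x i)"
      by (intro sum.cong) (auto intro: antisym le)
    then have "real r * x i = 1" using assms by (simp add: cuts_iff del: One_nat_def)
    then show ?thesis using True by (simp add: equal_cut_def field_simps)
  next
    case False
    then show ?thesis using assms by (simp add: cuts_iff equal_cut_def del: One_nat_def)
  qed
qed

text \<open>The factor \<open>1 / 2\<close> stands for any constant strictly between 0 and 1: below
  1 it makes the other tiles strictly less attractive, and being positive it keeps empty tiles from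
  being preferred.\<close>

definition weight :: "nat \<Rightarrow> nat \<Rightarrow> nat \<Rightarrow> real" where
  "weight r j i = (if i = j \<or> i = rotation r j then 1 else 1 / 2)"

definition cyclic_preferences :: "nat \<Rightarrow> preference_matrix" where
  "cyclic_preferences r j i = {x \<in> cuts r. \<forall>k<r. weight r j k * x k \<le> weight r j i * x i}"

lemma preferences_cyclic_preferences: "preferences r (cyclic_preferences r)"
  by (auto simp: preferences_def cyclic_preferences_def)

lemma closedin_cyclic_preferences:
  "closedin (top_of_set (cuts r)) (cyclic_preferences r j i)"
proof -
  have "closed {x :: nat \<Rightarrow> real. \<forall>k<r. weight r j k * x k \<le> weight r j i * x i}"
    by (intro closed_Collect_all closed_Collect_imp closed_Collect_le continuous_intros) auto
  then show ?thesis
    by (auto simp: closedin_closed cyclic_preferences_def)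
qed

lemma cyclic_preferences_cover:
  assumes "r > 0"
  shows "(\<Union>i<r. cyclic_preferences r j i) = cuts r"
proof -
  have "\<exists>i<r. \<forall>k<r. weight r j k * x k \<le> weight r j i * x i" for x
  proof -
    let ?M = "(\<lambda>k. weight r j k * x k) ` {..<r}"
    have "Max ?M \<in> ?M" using assms by (intro Max_in) auto
    then obtain i where "i < r" "Max ?M = weight r j i * x i" by auto
    moreover have "weight r j k * x k \<le> Max ?M" if "k < r" for k using that by simp
    ultimately show ?thesis by auto
  qed
  then show ?thesis by (auto simp: cyclic_preferences_def)
qed

text \<open>If an empty tile attained the maximum, all weighted lengths would be at most 0. The
  weights are positive, so the lengths could not sum to 1.\<close>

lemma cyclic_preferences_nonzero:
  assumes "r > 0" "x \<in> cyclic_preferences r j i"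
  shows "x i \<noteq> 0"
proof
  assume "x i = 0"
  then have "weight r j k * x k \<le> 0" if "k < r" for k
    using assms(2) that by (auto simp: cyclic_preferences_def)
  then have "x k \<le> 0" if "k < r" for k
    using that by (fastforce simp: weight_def split: if_splits)
  then have "(\<Sum>k<r. x k) \<le> 0" by (intro sum_nonpos) auto
  then show False using assms by (simp add: cyclic_preferences_def cuts_iff del: One_nat_def)
qed

lemma envy_free_unique:
  assumes "r \<ge> 2" "\<pi> permutes {..<r}"
    and pref: "\<And>j. j < r \<Longrightarrow> x \<in> cyclic_preferences r j (\<pi> j)"
  shows "x = equal_cut r \<and> (\<pi> = id \<or> \<pi> = rotation r)"
proof -
  have x: "x \<in> cuts r" using pref[of 0] assms(1) by (simp add: cyclic_preferences_def)
  have nonneg: "x k \<ge> 0" for k using x assms(1) by (simp add: cuts_iff del: One_nat_def)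
  have own: "x j \<le> weight r j (\<pi> j) * x (\<pi> j)" if "j < r" for j
    using pref[OF that] that by (auto simp: cyclic_preferences_def weight_def)
  have nxt: "x (rotation r j) \<le> weight r j (\<pi> j) * x (\<pi> j)" if "j < r" for j
  proof -
    have "weight r j (rotation r j) * x (rotation r j) \<le> weight r j (\<pi> j) * x (\<pi> j)"
      using pref[OF that] rotation_less[OF that] unfolding cyclic_preferences_def by blast
    then show ?thesis by (simp add: weight_def)
  qed
  have weighted: "weight r j i * x i \<le> x i" for j i
    using nonneg[of i] by (simp add: weight_def)
  have "(\<Sum>j<r. x j) = (\<Sum>j<r. x (\<pi> j))"
    using sum.permute[OF assms(2), of x] by (simp add: comp_def)
  then have eq: "x j = x (\<pi> j)" if "j < r" for j
    using that by (intro sum_mono_inv[of x "{..<r}" "\<lambda>j. x (\<pi> j)"])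
      (auto intro: order_trans[OF own weighted])
  have "\<pi> j = j \<or> \<pi> j = rotation r j" if "j < r" for j
  proof (rule ccontr)
    assume "\<not> ?thesis"
    \<comment> \<open>Any other tile counts half for player \<open>j\<close>, while
      \<open>eq\<close> makes it exactly as long as tile \<open>j\<close>. Its length would have to
      be 0, but preferred tiles are nonempty.\<close>
    then have "x (\<pi> j) \<le> x (\<pi> j) / 2"
      using own[OF that] eq[OF that] by (simp add: weight_def)
    moreover have "x (\<pi> j) \<noteq> 0"
      using cyclic_preferences_nonzero[OF _ pref[OF that]] assms(1) by simp
    ultimately show False using nonneg[of "\<pi> j"] by linarith
  qed
  then have "\<pi> = id \<or> \<pi> = rotation r"
    using permutes_id_or_rotation assms(1,2) by blast
  moreover have "x = equal_cut r"
  proof (rule cut_eq_equal_cut[OF _ x])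
    show "x (rotation r j) \<le> x j" if "j < r" for j
      using order_trans[OF nxt[OF that] weighted] eq[OF that] by simp
  qed (use assms(1) in simp)
  ultimately show ?thesis by blast
qed

text \<open>With all lengths equal, the maximum is attained at the weight 1, which both tiles
  \<open>j\<close> and \<open>rotation r j\<close> carry.\<close>

lemma equal_cut_preferred:
  assumes "r > 0" "i < r" "i = j \<or> i = rotation r j"
  shows "equal_cut r \<in> cyclic_preferences r j i"
  using assms equal_cut_in_cuts[of r]
  by (auto simp: cyclic_preferences_def weight_def equal_cut_def divide_simps)

lemma envy_free_divisions_cyclic_preferences:
  assumes "r \<ge> 2"
  shows "envy_free_divisions r (cyclic_preferences r)
    = {(equal_cut r, id), (equal_cut r, rotation r)}"
proof (intro equalityI subsetI)
  fix d assume "d \<in> envy_free_divisions r (cyclic_preferences r)"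
  then show "d \<in> {(equal_cut r, id), (equal_cut r, rotation r)}"
    using envy_free_unique[OF assms] by (auto simp: envy_free_divisions_def divisions_def)
next
  fix d assume "d \<in> {(equal_cut r, id), (equal_cut r, rotation r)}"
  then show "d \<in> envy_free_divisions r (cyclic_preferences r)"
    using assms equal_cut_in_cuts[of r] rotation_permutes[of r] permutes_id[of "{..<r}"]
    by (auto simp: envy_free_divisions_def divisions_def rotation_less
        intro!: equal_cut_preferred)
qed

theorem theorem2p3:
  fixes r :: nat
  assumes "r \<ge> 2"
  shows "\<exists>A :: preference_matrix.
    preferences r A \<and>
    (\<forall>j<r. \<forall>i<r. closedin (top_of_set (cuts r)) (A j i)) \<and>
    (\<forall>j<r. (\<Union>i<r. A j i) = cuts r) \<and>
    (\<forall>j<r. \<forall>i<r. A j i \<inter> {x \<in> cuts r. x i = 0} = {}) \<and>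
    card (envy_free_divisions r A) = 2"
proof -
  have "r > 0" using assms by simp
  \<comment> \<open>The two divisions share their cut, so they differ only through their
    permutations; index \<open>0\<close> separates these.\<close>
  have "rotation r \<noteq> id" using rotation_neq[OF assms, of 0] assms by auto
  then have "card (envy_free_divisions r (cyclic_preferences r)) = 2"
    unfolding envy_free_divisions_cyclic_preferences[OF assms] by (simp add: card_insert_if)
  then show ?thesis
    using preferences_cyclic_preferences closedin_cyclic_preferences
      cyclic_preferences_cover[OF \<open>r > 0\<close>] cyclic_preferences_nonzero[OF \<open>r > 0\<close>]
    by (intro exI[of _ "cyclic_preferences r"]) blast
qed

end
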